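(* Let $I \subseteq \mathbb{R}$ be an interval with interior $I^{\circ}$, let $f: I \to \mathbb{R}$ be three times differentiable on $I^{\circ}$, let $a,b \in I^{\circ}$ with $a<b$, and suppose $f''' \in L[a,b]$. Then $$f\left(\frac{a+b}{2}\right) - \frac{1}{b-a}\int_a^b f(x)\,dx + \frac{b-a}{24}\,[f'(b)-f'(a)]$$ $$= \frac{(b-a)^3}{24}\left[\int_0^{\frac12}\lambda(1-2\lambda)(1+2\lambda)f'''(\lambda a+(1-\lambda)b)\,d\lambda - \int_0^{\frac12}\lambda(1-2\lambda)(1+2\lambda)f'''(\lambda b+(1-\lambda)a)\,d\lambda\right].$$
   Context: $L[a,b]$ denotes the Lebesgue integrable functions on $[a,b]$. *)

theory Defs
  imports "HOL-Analysis.Analysis"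
begin

end

theory Submission
  imports Defs
begin

text \<open>The kernel $k(l) = l(1-2l)(1+2l) = l - 4l^3$ vanishes at $0$ and $1/2$ and has $k''' = -24$.
  Hence integrating $k(l) f'''(c + ld)$ by parts three times and multiplying by $d^3$ leaves boundary
  terms and $24 \int f(c + ld)\,dl$. Take $(c, d) = (b, a - b)$ and $(a, b - a)$: in the sum the
  terms in $f'$ at the midpoint cancel, and the two integrals of $f$ make up
  the integral over $[a,b]$. As the third derivative need not be continuous, the integration by parts is the
  fundamental theorem for the Henstock-Kurzweil integral applied to one explicit
  antiderivative; Lebesgue integrability only serves to identify the two integrals.\<close>

text \<open>Change of variables: the Jacobian is the constant \<open>\<bar>d\<bar>\<close>, which is
  nonzero and can be divided out.\<close>

lemma absolutely_integrable_on_affine_image: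
  fixes g :: "real \<Rightarrow> 'a::euclidean_space"
  assumes "g absolutely_integrable_on (\<lambda>l. c + l * d) ` T" "T \<in> sets lebesgue" "d \<noteq> 0"
  shows "(\<lambda>l. g (c + l * d)) absolutely_integrable_on T"
proof -
  have "inj_on (\<lambda>l. c + l * d) T"
    using assms(3) by (auto simp: inj_on_def)
  moreover have "((\<lambda>l. c + l * d) has_field_derivative d) (at x within T)" for x
    by (auto intro!: derivative_eq_intros)
  ultimately have "(\<lambda>l. \<bar>d\<bar> *\<^sub>R g (c + l * d)) absolutely_integrable_on T"
    using absolutely_integrable_change_of_variables_real[of T "\<lambda>l. c + l * d" "\<lambda>_. d" g] assms(1,2)
    by blast
  then have "(\<lambda>l. (1 / \<bar>d\<bar>) *\<^sub>R \<bar>d\<bar> *\<^sub>R g (c + l * d)) absolutely_integrable_on T"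
    by (rule set_integrable_scaleR_right)
  then show ?thesis
    using assms(3) by simp
qed

text \<open>Threefold integration by parts on one half of the interval. A closed segment serves both
  signs of \<open>d\<close>, and derivatives within \<open>S\<close> suffice because only one-sided
  ones are used at its ends.\<close>

lemma kernel_integral:
  fixes F f f1 f2 f3 :: "real \<Rightarrow> real" and c d :: real
  defines "S \<equiv> closed_segment c (c + d / 2)"
  assumes d: "d \<noteq> 0"
    and F: "\<And>x. x \<in> S \<Longrightarrow> (F has_real_derivative f x) (at x within S)"
    and f: "\<And>x. x \<in> S \<Longrightarrow> (f has_real_derivative f1 x) (at x within S)"
    and f1: "\<And>x. x \<in> S \<Longrightarrow> (f1 has_real_derivative f2 x) (at x within S)"
    and f2: "\<And>x. x \<in> S \<Longrightarrow> (f2 has_real_derivative f3 x) (at x within S)"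
    and int: "f3 absolutely_integrable_on S"
  shows "d ^ 3 * (LINT l:{0..1/2}|lebesgue. l * (1 - 2 * l) * (1 + 2 * l) * f3 (c + l * d))
       = d * (2 * f1 (c + d / 2) + f1 c) - 12 * f (c + d / 2) + 24 / d * (F (c + d / 2) - F c)"
proof -
  define k where "k = (\<lambda>l::real. l * (1 - 2 * l) * (1 + 2 * l))"
  \<comment> \<open>With \<open>k' = 1 - 12 l^2\<close>, \<open>k'' = - 24 l\<close>,
    \<open>k''' = - 24\<close>, this is \<open>k d^2 f2 - k' d f1 + k'' f - (k''' / d) F\<close>;
    its derivative telescopes to \<open>d^3 k f3\<close>.\<close>
  define G where "G = (\<lambda>l. k l * d\<^sup>2 * f2 (c + l * d) - (1 - 12 * l\<^sup>2) * d * f1 (c + l * d)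
     - 24 * l * f (c + l * d) + 24 / d * F (c + l * d))"
  have img: "(\<lambda>l. c + l * d) ` {0..1/2} = S"
  proof -
    \<comment> \<open>Segments are images of the unit interval, so the parameter is rescaled by
      1/2.\<close>
    have "(\<lambda>l. c + l * d) ` {0..1/2} = (\<lambda>l. c + l * d) ` (*) (1/2) ` {0..1}"
      by simp
    then show ?thesis
      unfolding S_def closed_segment_real_eq by (simp only: image_image) (simp add: algebra_simps)
  qed
  have "(\<lambda>l. f3 (c + l * d)) absolutely_integrable_on {0..1/2}"
    using int d img by (intro absolutely_integrable_on_affine_image) auto
  moreover have "continuous_on {0..1/2} k"
    unfolding k_def by (intro continuous_intros)
  \<comment> \<open>The continuous kernel is bounded and measurable on the compact interval.\<close>
  ultimately have abs: "(\<lambda>l. k l * f3 (c + l * d)) absolutely_integrable_on {0..1/2}"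
    by (intro absolutely_integrable_bounded_measurable_product_real
          continuous_imp_measurable_on_sets_lebesgue compact_imp_bounded
          compact_continuous_image) auto
  have "(G has_vector_derivative d ^ 3 * (k l * f3 (c + l * d))) (at l within {0..1/2})"
    if l: "l \<in> {0..1/2}" for l
  proof -
    have comp: "((\<lambda>l. g (c + l * d)) has_real_derivative g' (c + l * d) * d) (at l within {0..1/2})"
      if "\<And>x. x \<in> S \<Longrightarrow> (g has_real_derivative g' x) (at x within S)" for g g'
    proof -
      have "(g has_real_derivative g' (c + l * d)) (at (c + l * d) within (\<lambda>l. c + l * d) ` {0..1/2})"
        using that img l by blast
      moreover have "((\<lambda>l. c + l * d) has_real_derivative d) (at l within {0..1/2})"
        by (auto intro!: derivative_eq_intros)
      ultimately show ?thesis
        using DERIV_image_chain[of g _ "\<lambda>l. c + l * d"] by (simp add: o_def)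
    qed
    have "(G has_real_derivative d ^ 3 * (k l * f3 (c + l * d))) (at l within {0..1/2})"
      unfolding G_def k_def using d
      by (auto intro!: derivative_eq_intros comp[OF F] comp[OF f] comp[OF f1] comp[OF f2])
         (simp add: algebra_simps power2_eq_square power3_eq_cube)
    then show ?thesis
      by (simp add: has_real_derivative_iff_has_vector_derivative)
  qed
  then have "((\<lambda>l. d ^ 3 * (k l * f3 (c + l * d))) has_integral G (1/2) - G 0) {0..1/2}"
    by (intro fundamental_theorem_of_calculus) auto
  then have "d ^ 3 * integral {0..1/2} (\<lambda>l. k l * f3 (c + l * d)) = G (1/2) - G 0"
    by (metis integral_mult_right integral_unique)
  \<comment> \<open>At \<open>l = 1/2\<close> the coefficients of \<open>f2\<close>,
    \<open>f1\<close>, \<open>f\<close> in \<open>G\<close> are \<open>0\<close>,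
    \<open>2 * d\<close>, \<open>-12\<close>; at \<open>l = 0\<close> they are \<open>0\<close>,
    \<open>-d\<close>, \<open>0\<close>.\<close>
  then show ?thesis
    using set_lebesgue_integral_eq_integral(2)[OF abs]
    by (simp add: k_def G_def power2_eq_square algebra_simps)
qed

theorem lemma2p5:
  fixes I :: "real set" and f :: "real \<Rightarrow> real" and a b :: real
  assumes "is_interval I"
    and "f differentiable_on interior I"
    and "deriv f differentiable_on interior I"
    and "deriv (deriv f) differentiable_on interior I"
    and "a \<in> interior I" and "b \<in> interior I" and "a < b"
    and "set_integrable lebesgue {a..b} (deriv (deriv (deriv f)))"
  shows "f ((a + b) / 2) - 1 / (b - a) * (LINT x:{a..b}|lebesgue. f x)
           + (b - a) / 24 * (deriv f b - deriv f a)
       = (b - a) ^ 3 / 24 *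
          ((LINT l:{0..1/2}|lebesgue.
              l * (1 - 2 * l) * (1 + 2 * l) * deriv (deriv (deriv f)) (l * a + (1 - l) * b))
         - (LINT l:{0..1/2}|lebesgue.
              l * (1 - 2 * l) * (1 + 2 * l) * deriv (deriv (deriv f)) (l * b + (1 - l) * a)))"
proof -
  have sub: "{a..b} \<subseteq> interior I"
    using assms(1,5,6) by (meson atLeastAtMost_iff convex_interior is_interval_convex_1 mem_is_interval_1_I subsetI)
  have D: "(g has_real_derivative deriv g x) (at x within S)"
    if "g differentiable_on interior I" "x \<in> {a..b}" for g x S
    using that sub
    by (metis DERIV_deriv_iff_real_differentiable at_within_open differentiable_on_def
        has_field_derivative_at_within open_interior subsetD)
  have cont: "continuous_on {a..b} f"
    using D[OF assms(2)] DERIV_continuous_on by blast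
  \<comment> \<open>Left of \<open>a\<close> this is constantly 0, so at \<open>a\<close> only the
    derivative within \<open>{a..b}\<close> is claimed.\<close>
  define F where "F x = integral {a..x} f" for x
  have F: "(F has_real_derivative f x) (at x within {a..b})" if "x \<in> {a..b}" for x
    unfolding F_def using cont that by (rule integral_has_real_derivative)
  have Fab: "(LINT x:{a..b}|lebesgue. f x) = F b - F a"
    using set_lebesgue_integral_eq_integral(2)[OF absolutely_integrable_continuous_real[OF cont]]
    by (simp add: F_def)
  let ?J = "\<lambda>c d. LINT l:{0..1/2}|lebesgue. l * (1 - 2 * l) * (1 + 2 * l) * deriv (deriv (deriv f)) (c + l * d)"
  have K: "d ^ 3 * ?J c d
      = d * (2 * deriv f ((a + b) / 2) + deriv f c) - 12 * f ((a + b) / 2)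
        + 24 / d * (F ((a + b) / 2) - F c)"
    if "d \<noteq> 0" "c \<in> {a..b}" and mid: "c + d / 2 = (a + b) / 2" for c d
    \<comment> \<open>The midpoint is written as \<open>c + d / 2\<close> to match
      \<open>kernel_integral\<close>, whose conclusion does not mention \<open>f2\<close>; hence the
      explicit instance.\<close>
    unfolding mid[symmetric]
  proof (rule kernel_integral[OF that(1), where ?f2.0 = "deriv (deriv f)"])
    have seg: "closed_segment c (c + d / 2) \<subseteq> {a..b}"
      using that assms(7) unfolding mid by (intro closed_segment_subset) auto
    show "deriv (deriv (deriv f)) absolutely_integrable_on closed_segment c (c + d / 2)"
      using seg by (intro set_integrable_subset[OF assms(8)]) (auto simp: closed_segment_eq_real_ivl)
    fix x assume "x \<in> closed_segment c (c + d / 2)"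
    with seg have x: "x \<in> {a..b}" by blast
    show "(F has_real_derivative f x) (at x within closed_segment c (c + d / 2))"
      using F[OF x] seg by (rule has_field_derivative_subset)
      show "(f has_real_derivative deriv f x) (at x within closed_segment c (c + d / 2))"
      "(deriv f has_real_derivative deriv (deriv f) x) (at x within closed_segment c (c + d / 2))"
      "(deriv (deriv f) has_real_derivative deriv (deriv (deriv f)) x) (at x within closed_segment c (c + d / 2))"
      using D x assms(2,3,4) by blast+
  qed
  have J: "(a - b) ^ 3 * ?J b (a - b)
      = (a - b) * (2 * deriv f ((a + b) / 2) + deriv f b) - 12 * f ((a + b) / 2)
        + 24 / (a - b) * (F ((a + b) / 2) - F b)"
    using assms(7) by (intro K) (auto simp: field_simps)
  have J': "(b - a) ^ 3 * ?J a (b - a)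
      = (b - a) * (2 * deriv f ((a + b) / 2) + deriv f a) - 12 * f ((a + b) / 2)
        + 24 / (b - a) * (F ((a + b) / 2) - F a)"
    using assms(7) by (intro K) (auto simp: field_simps)
  \<comment> \<open>The cube is odd, so \<open>(b - a) ^ 3 = - ((a - b) ^ 3)\<close>. In the sum
    below the values of \<open>F\<close> at the midpoint cancel too.\<close>
  have "(b - a) ^ 3 * (?J b (a - b) - ?J a (b - a))
      = - ((a - b) ^ 3 * ?J b (a - b)) - (b - a) ^ 3 * ?J a (b - a)"
    by (simp add: power3_eq_cube algebra_simps)
  also have "\<dots> = (b - a) * (deriv f b - deriv f a) + 24 * f ((a + b) / 2) - 24 * (1 / (b - a) * (F b - F a))"
    unfolding J J' using assms(7) by (simp add: divide_simps) (simp add: algebra_simps)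
  finally have scaled: "(b - a) ^ 3 * (?J b (a - b) - ?J a (b - a))
      = (b - a) * (deriv f b - deriv f a) + 24 * f ((a + b) / 2) - 24 * (1 / (b - a) * (F b - F a))" .
  have "f ((a + b) / 2) - 1 / (b - a) * (F b - F a) + (b - a) / 24 * (deriv f b - deriv f a)
      = (b - a) ^ 3 / 24 * (?J b (a - b) - ?J a (b - a))"
    using scaled by linarith
  moreover have "b + l * (a - b) = l * a + (1 - l) * b" "a + l * (b - a) = l * b + (1 - l) * a" for l
    by (simp_all add: algebra_simps)
  ultimately show ?thesis
    by (simp only: Fab)
qed

end
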